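(* (Gödel's completeness theorem for formal systems of this kind.) Let $\langle CN,VR,\mathrm{Type},\Gamma\rangle$ be a formal system. A statement $\langle DV,\emptyset,A\rangle$ of the formal system is a theorem if and only if it is true in every model of the formal system, where $A\in EX$ is called true in a model $\langle U,\#,\eta\rangle$ if $\eta_\mu(A)$ is defined for all valuations $\mu\in VL$.
   Context: **Formal systems.** $CN$ (constants) and $VR$ (variables) are disjoint sets; $\mathrm{Type}:VR\to CN$ is a function; $VT=\{\mathrm{Type}(v)\mid v\in VR\}$. $EX$ (expressions) is the set of nonempty finite sequences $e$ over $CN\cup VR$ with $e_0\in CN$; $\mathrm{Type}(e)=e_0$; $\mathcal V(e)$ is the set of variables occurring in $e$ (and $\mathcal V$ of a set of expressions is the set of variables occurring in its members). $DV$ is the set of two-element subsets of $VR$. For $v\in VR$, $VH_v=\langle\mathrm{Type}(v),v\rangle\in EX$. A substitution is a function $\sigma:EX\to EX$ with $\sigma(\langle c\rangle)=\langle c\rangle$ for $c\in CN$ and $\sigma(gh)=\sigma(g)\sigma(h)$, where adjacency is concatenation of sequences; it is determined by its values on the one-term sequences $\langle v\rangle$, $v\in VR$ (so $\sigma$ is understood to act on these too). A pre-statement is a triple $\langle D,H,A\rangle$ with $D\subseteq DV$, $H\subseteq EX$ finite and $A\in EX$. Its reduct is $\langle D_M,H,A\rangle$, where $D_M$ is the set of those pairs in $D$ that are subsets of $\mathcal V(H\cup\{A\})$. A statement is the reduct of some pre-statement; the statement $\langle DV,\emptyset,A\rangle$ means the reduct of this triple, i.e. there are no hypotheses and all variables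 are required to be distinct. A formal system is a tuple $\langle CN,VR,\mathrm{Type},\Gamma\rangle$ with $\Gamma$ a set of statements. $TC=VT\cup\{\mathrm{Type}(A)\mid\langle D,H,A\rangle\in\Gamma\}$. The closure of $H\subseteq EX$ relative to $D$ is the smallest set $C$ such that $H\cup\{VH_v\mid v\in VR\}\subseteq C$ and, for every $\langle D',H',A'\rangle\in\Gamma$ and every substitution $\sigma$, if (i) $\sigma(e)\in C$ for all $e\in H'\cup\{VH_v\mid v\in VR\}$, and (ii) for all $\{\alpha,\beta\}\in D'$, if $\gamma\in\mathcal V(\sigma(VH_\alpha))$ and $\delta\in\mathcal V(\sigma(VH_\beta))$ then $\{\gamma,\delta\}\in D$, then $\sigma(A')\in C$. A pre-statement $\langle D,H,A\rangle$ is provable if $A$ is in the closure of $H$ relative to $D$; a theorem is a statement that is the reduct of a provable pre-statement. **Models.** Let $U$ assign a set $U_c$ to each $c\in TC$. A valuation is a function $\mu$ on $VR$ with $\mu(v)\in U_{\mathrm{Type}(v)}$ for all $v\in VR$; $VL$ is the set of all valuations. A freshness relation is a symmetric relation $\#$ on the disjoint union $\bigsqcup U=\bigsqcup_{c\in TC}U_c$ such that for any $c\in VT$ and any finite $W\subseteq\bigsqcup U$ there is $v\in U_c$ with $v\# w$ for all $w\in W$. A model of $\langle CN,VR,\mathrm{Type},\Gamma\rangle$ is a tuple $\langle U,\#,\eta\rangle$ where $U$ is a function on $TC$, $\#$ is a freshness relation and, for each $\mu\in VL$, $\eta_\mu$ is a partial function on $EX$ such that (equality means that one side is defined iff the other is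 and they have the same value): - (Type correctness) for all $e\in EX$, if $\eta_\mu(e)$ is defined then $\eta_\mu(e)\in U_{\mathrm{Type}(e)}$; - (Variable application) $\eta_\mu(VH_v)=\mu(v)$ for all $v\in VR$; - (Axiom application) for each $\langle D,H,A\rangle\in\Gamma$, if $\mu(\alpha)\#\mu(\beta)$ for all $\{\alpha,\beta\}\in D$ and $\eta_\mu(h)$ is defined for all $h\in H$, then $\eta_\mu(A)$ is defined; - (Substitution property) for each substitution $\sigma$ and $e\in EX$, $\eta_\mu(\sigma(e))=\eta_{\sigma(\mu)}(e)$, where $\sigma(\mu)\in VL$ is defined by $\sigma(\mu)(v)=\eta_\mu(\sigma(VH_v))$; - (Dependence on present variables) for all $\nu\in VL$ and $e\in EX$, if $\mu(v)=\nu(v)$ for all $v\in\mathcal V(e)$, then $\eta_\mu(e)=\eta_\nu(e)$; - (Freshness substitution) for all $v\in\bigsqcup U$ and $e\in EX$, if $\eta_\mu(e)$ is defined and $v\#\mu(w)$ for all $w\in\mathcal V(e)$, then $v\#\eta_\mu(e)$.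
   Formalization: Added: infinitely many variables of each type in VT. Truth of ⟨DV,∅,A⟩ ranges only over valuations μ with μ(α)#μ(β) for distinct α,β in A; truth for all μ is instead matched with ⟨∅,∅,A⟩. The literal equivalence fails in both directions. *)

theory Defs
  imports Main "HOL-Library.FuncSet"
begin

record 's formal_system =
  CN :: "'s set"
  VR :: "'s set"
  Type :: "'s \<Rightarrow> 's"
  Ax :: "('s set set \<times> 's list set \<times> 's list) set"

type_synonym 's statement = "'s set set \<times> 's list set \<times> 's list"

definition VT :: "'s formal_system \<Rightarrow> 's set" where
  "VT F = Type F ` VR F"

definition EXP :: "'s formal_system \<Rightarrow> 's list set" where
  "EXP F = {e \<in> lists (CN F \<union> VR F). e \<noteq> [] \<and> hd e \<in> CN F}"

abbreviation etype :: "'s list \<Rightarrow> 's" where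
  "etype e \<equiv> hd e"

definition vars :: "'s formal_system \<Rightarrow> 's list \<Rightarrow> 's set" where
  "vars F e = set e \<inter> VR F"

definition DV :: "'s formal_system \<Rightarrow> 's set set" where
  "DV F = {{\<alpha>, \<beta>} | \<alpha> \<beta>. \<alpha> \<in> VR F \<and> \<beta> \<in> VR F \<and> \<alpha> \<noteq> \<beta>}"

definition VH :: "'s formal_system \<Rightarrow> 's \<Rightarrow> 's list" where
  "VH F v = [Type F v, v]"

text \<open>A substitution is a map of expressions that is understood to act on the one-term
  sequences of variables as well. It is therefore a map of all finite sequences of symbols;
  the conditions imply that it maps expressions to expressions.\<close>

definition substitution :: "'s formal_system \<Rightarrow> ('s list \<Rightarrow> 's list) \<Rightarrow> bool" where
  "substitution F \<sigma> \<longleftrightarrow>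
     \<sigma> \<in> lists (CN F \<union> VR F) \<rightarrow> lists (CN F \<union> VR F) \<and>
     (\<forall>c \<in> CN F. \<sigma> [c] = [c]) \<and>
     (\<forall>g \<in> lists (CN F \<union> VR F). \<forall>h \<in> lists (CN F \<union> VR F). \<sigma> (g @ h) = \<sigma> g @ \<sigma> h)"

definition pre_statement :: "'s formal_system \<Rightarrow> 's statement \<Rightarrow> bool" where
  "pre_statement F = (\<lambda>(D, H, A). D \<subseteq> DV F \<and> H \<subseteq> EXP F \<and> finite H \<and> A \<in> EXP F)"

definition reduct :: "'s formal_system \<Rightarrow> 's statement \<Rightarrow> 's statement" where
  "reduct F = (\<lambda>(D, H, A). ({d \<in> D. d \<subseteq> (\<Union>e \<in> insert A H. vars F e)}, H, A))"

definition is_statement :: "'s formal_system \<Rightarrow> 's statement \<Rightarrow> bool" where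
  "is_statement F S \<longleftrightarrow> (\<exists>P. pre_statement F P \<and> S = reduct F P)"

definition formal_system :: "'s formal_system \<Rightarrow> bool" where
  "formal_system F \<longleftrightarrow>
     CN F \<inter> VR F = {} \<and> Type F \<in> VR F \<rightarrow> CN F \<and> (\<forall>S \<in> Ax F. is_statement F S)"

definition TC :: "'s formal_system \<Rightarrow> 's set" where
  "TC F = VT F \<union> {etype A | D H A. (D, H, A) \<in> Ax F}"

inductive_set fs_closure :: "'s formal_system \<Rightarrow> 's set set \<Rightarrow> 's list set \<Rightarrow> 's list set"
  for F :: "'s formal_system" and D :: "'s set set" and H :: "'s list set" where
  hyp: "e \<in> H \<Longrightarrow> e \<in> fs_closure F D H"
| var: "v \<in> VR F \<Longrightarrow> VH F v \<in> fs_closure F D H"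
| ax: "\<lbrakk>(D', H', A') \<in> Ax F; substitution F \<sigma>;
        \<forall>e \<in> H'. \<sigma> e \<in> fs_closure F D H;
        \<forall>v \<in> VR F. \<sigma> (VH F v) \<in> fs_closure F D H;
        \<forall>\<alpha> \<beta> \<gamma> \<delta>. {\<alpha>, \<beta>} \<in> D' \<and> \<gamma> \<in> vars F (\<sigma> (VH F \<alpha>)) \<and> \<delta> \<in> vars F (\<sigma> (VH F \<beta>))
           \<longrightarrow> {\<gamma>, \<delta>} \<in> D\<rbrakk>
       \<Longrightarrow> \<sigma> A' \<in> fs_closure F D H"

definition provable :: "'s formal_system \<Rightarrow> 's statement \<Rightarrow> bool" where
  "provable F = (\<lambda>(D, H, A). A \<in> fs_closure F D H)"

definition is_theorem :: "'s formal_system \<Rightarrow> 's statement \<Rightarrow> bool" where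
  "is_theorem F S \<longleftrightarrow> (\<exists>P. pre_statement F P \<and> provable F P \<and> S = reduct F P)"

text \<open>The universes \<open>U\<^sub>c\<close> are sets of elements of a type \<open>'u\<close>. Elements of their disjoint union
  are pairs \<open>(c, x)\<close> with \<open>x \<in> U\<^sub>c\<close>, and freshness is a relation between such pairs.
  A partial function is option-valued, so equality of its values already means that one side
  is defined iff the other is and that they agree.\<close>

record ('s, 'u) fs_model =
  universe :: "'s \<Rightarrow> 'u set"
  fresh :: "(('s \<times> 'u) \<times> ('s \<times> 'u)) set"
  eta :: "('s \<Rightarrow> 'u) \<Rightarrow> 's list \<Rightarrow> 'u option"

definition DU :: "'s formal_system \<Rightarrow> ('s \<Rightarrow> 'u set) \<Rightarrow> ('s \<times> 'u) set" where
  "DU F U = (SIGMA c : TC F. U c)"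

definition VL :: "'s formal_system \<Rightarrow> ('s \<Rightarrow> 'u set) \<Rightarrow> ('s \<Rightarrow> 'u) set" where
  "VL F U = (\<Pi>\<^sub>E v \<in> VR F. U (Type F v))"

definition freshness_relation ::
    "'s formal_system \<Rightarrow> ('s \<Rightarrow> 'u set) \<Rightarrow> (('s \<times> 'u) \<times> ('s \<times> 'u)) set \<Rightarrow> bool" where
  "freshness_relation F U R \<longleftrightarrow>
     R \<subseteq> DU F U \<times> DU F U \<and> sym R \<and>
     (\<forall>c \<in> VT F. \<forall>W. finite W \<and> W \<subseteq> DU F U \<longrightarrow> (\<exists>v \<in> U c. \<forall>w \<in> W. ((c, v), w) \<in> R))"

text \<open>The element \<open>\<mu>(v)\<close> regarded as an element of the disjoint union.\<close>

definition tagged :: "'s formal_system \<Rightarrow> ('s \<Rightarrow> 'u) \<Rightarrow> 's \<Rightarrow> 's \<times> 'u" where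
  "tagged F \<mu> v = (Type F v, \<mu> v)"

text \<open>The condition that \<open>\<mu>\<close> respects the distinct variable pairs \<open>D\<close>.\<close>

definition respects_dv ::
    "'s formal_system \<Rightarrow> ('s, 'u) fs_model \<Rightarrow> ('s \<Rightarrow> 'u) \<Rightarrow> 's set set \<Rightarrow> bool" where
  "respects_dv F M \<mu> D \<longleftrightarrow>
     (\<forall>\<alpha> \<beta>. {\<alpha>, \<beta>} \<in> D \<longrightarrow> (tagged F \<mu> \<alpha>, tagged F \<mu> \<beta>) \<in> fresh M)"

definition subst_valuation ::
    "'s formal_system \<Rightarrow> ('s, 'u) fs_model \<Rightarrow> ('s list \<Rightarrow> 's list) \<Rightarrow> ('s \<Rightarrow> 'u) \<Rightarrow> ('s \<Rightarrow> 'u)" where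
  "subst_valuation F M \<sigma> \<mu> = (\<lambda>v \<in> VR F. the (eta M \<mu> (\<sigma> (VH F v))))"

text \<open>The substitution property concerns those \<open>\<sigma>\<close> and \<open>\<mu>\<close> for which \<open>\<sigma>(\<mu>)\<close> is a valuation, that
  is, for which \<open>\<eta>\<^sub>\<mu>(\<sigma>(VH\<^sub>v))\<close> is defined for every variable \<open>v\<close>; by type correctness it then
  lies in the universe of the type of \<open>v\<close>. Universes are only given for the elements of
  \<open>TC\<close>, so type correctness includes \<open>Type(e) \<in> TC\<close>.\<close>

definition is_model :: "'s formal_system \<Rightarrow> ('s, 'u) fs_model \<Rightarrow> bool" where
  "is_model F M \<longleftrightarrow>
     freshness_relation F (universe M) (fresh M) \<and>
     (\<forall>\<mu> \<in> VL F (universe M).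
        (\<forall>e \<in> EXP F. \<forall>x. eta M \<mu> e = Some x \<longrightarrow> etype e \<in> TC F \<and> x \<in> universe M (etype e)) \<and>
        (\<forall>v \<in> VR F. eta M \<mu> (VH F v) = Some (\<mu> v)) \<and>
        (\<forall>(D, H, A) \<in> Ax F.
           respects_dv F M \<mu> D \<and> (\<forall>h \<in> H. eta M \<mu> h \<noteq> None) \<longrightarrow> eta M \<mu> A \<noteq> None) \<and>
        (\<forall>\<sigma>. substitution F \<sigma> \<and> (\<forall>v \<in> VR F. eta M \<mu> (\<sigma> (VH F v)) \<noteq> None) \<longrightarrow>
           (\<forall>e \<in> EXP F. eta M \<mu> (\<sigma> e) = eta M (subst_valuation F M \<sigma> \<mu>) e)) \<and>
        (\<forall>\<nu> \<in> VL F (universe M). \<forall>e \<in> EXP F.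
           (\<forall>v \<in> vars F e. \<mu> v = \<nu> v) \<longrightarrow> eta M \<mu> e = eta M \<nu> e) \<and>
        (\<forall>p \<in> DU F (universe M). \<forall>e \<in> EXP F. \<forall>x.
           eta M \<mu> e = Some x \<and> (\<forall>w \<in> vars F e. (p, tagged F \<mu> w) \<in> fresh M) \<longrightarrow>
           (p, (etype e, x)) \<in> fresh M))"

definition true_in :: "'s formal_system \<Rightarrow> ('s, 'u) fs_model \<Rightarrow> 's list \<Rightarrow> bool" where
  "true_in F M A \<longleftrightarrow> (\<forall>\<mu> \<in> VL F (universe M). eta M \<mu> A \<noteq> None)"

text \<open>Truth of a statement, as opposed to an expression: the valuations are restricted by its
  distinct variable conditions and its hypotheses, exactly as in the axiom clause for models.
  For \<open>\<langle>\<emptyset>, \<emptyset>, A\<rangle>\<close> this is truth of the expression \<open>A\<close>. For \<open>\<langle>DV, \<emptyset>, A\<rangle>\<close> it is weaker, and soundness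
  holds only for the weaker notion: if the one axiom is \<open>\<langle>{{x,y}}, \<emptyset>, p x y\<rangle>\<close>, there is a model
  in which \<open>\<eta>\<^sub>\<mu>(p x y)\<close> is undefined whenever \<open>\<mu>(x) = \<mu>(y)\<close>.

  Both notions are relative to the type \<open>'u\<close> of elements. Universes of expressions (\<open>'u = 's list\<close>)
  accommodate the term models and so suffice for completeness, whereas soundness is meant for every
  \<open>'u\<close>.\<close>

definition statement_true_in :: "'s formal_system \<Rightarrow> ('s, 'u) fs_model \<Rightarrow> 's statement \<Rightarrow> bool" where
  "statement_true_in F M = (\<lambda>(D, H, A). \<forall>\<mu> \<in> VL F (universe M).
     respects_dv F M \<mu> D \<and> (\<forall>h \<in> H. eta M \<mu> h \<noteq> None) \<longrightarrow> eta M \<mu> A \<noteq> None)"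

end

theory Submission
  imports Defs
begin

text \<open>Soundness: a derivation uses only finitely many variables, because a substitution applied
  to an axiom matters only on the variables of that axiom. Hence a valuation that respects the
  distinct variable conditions of the reduct can be altered on the finitely many dummy variables of a
  derivation, giving them fresh values, so that it respects all conditions that the derivation uses.

  Completeness: let \<open>V\<close> be the set of variables of the statement, and extend its distinct variable
  conditions to \<open>D\<close> by all pairs that are not subsets of \<open>V\<close>. The closure relative to \<open>D\<close> is the
  universe of a term model, where two expressions are fresh for each other if all pairs of their
  variables are in \<open>D\<close>; a variable outside \<open>V\<close> and outside a finite set of expressions is fresh for
  all of them. In this model the valuation \<open>v \<mapsto> VH\<^sub>v\<close> makes exactly the members of the closure
  defined.\<close>

section \<open>Reducts, distinct variable pairs and expressions\<close>

lemma reduct_eq: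
  "reduct F (D, H, A) = (D \<inter> Pow (\<Union>e \<in> insert A H. vars F e), H, A)"
  by (auto simp: reduct_def)

lemma pair_in_DV_iff: "{\<alpha>, \<beta>} \<in> DV F \<longleftrightarrow> \<alpha> \<in> VR F \<and> \<beta> \<in> VR F \<and> \<alpha> \<noteq> \<beta>"
  by (auto simp: DV_def doubleton_eq_iff)

lemma pair_in_subset_DV:
  assumes "{\<alpha>, \<beta>} \<in> D" "D \<subseteq> DV F"
  shows "\<alpha> \<in> VR F" "\<beta> \<in> VR F" "\<alpha> \<noteq> \<beta>"
  using subsetD[OF assms(2,1)] by (simp_all add: pair_in_DV_iff)

lemma finite_vars: "finite (vars F e)"
  by (simp add: vars_def)

lemma respects_dv_mono: "respects_dv F M \<mu> E" if "respects_dv F M \<mu> D" "E \<subseteq> D"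
  using that by (auto simp: respects_dv_def)

lemma VL_mem: "\<mu> v \<in> U (Type F v)" if "\<mu> \<in> VL F U" "v \<in> VR F"
  using that by (auto simp: VL_def)

context
  fixes F :: "'s formal_system"
  assumes fs: "formal_system F"
begin

lemma Type_in_CN: "v \<in> VR F \<Longrightarrow> Type F v \<in> CN F"
  and CN_not_VR: "c \<in> CN F \<Longrightarrow> c \<notin> VR F"
  using fs by (auto simp: formal_system_def)

lemma Type_in_TC: "v \<in> VR F \<Longrightarrow> Type F v \<in> TC F"
  by (simp add: TC_def VT_def)

lemma tagged_in_DU: "tagged F \<mu> v \<in> DU F U" if "\<mu> \<in> VL F U" "v \<in> VR F"
  using VL_mem[OF that] Type_in_TC[OF that(2)] by (simp add: tagged_def DU_def)

lemma VH_in_EXP: "v \<in> VR F \<Longrightarrow> VH F v \<in> EXP F"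
  by (simp add: EXP_def VH_def Type_in_CN)

lemma vars_VH: "v \<in> VR F \<Longrightarrow> vars F (VH F v) = {v}"
  using Type_in_CN CN_not_VR by (auto simp: vars_def VH_def)

lemma EXP_in_lists: "e \<in> EXP F \<Longrightarrow> e \<in> lists (CN F \<union> VR F)"
  by (simp add: EXP_def)

text \<open>Axioms are statements, hence reducts, so their distinct variable pairs involve only
  their own variables. A substitution can therefore be altered on all other variables without
  affecting condition (ii) of the closure rule.\<close>

lemma axiomD:
  assumes "(D, H, A) \<in> Ax F"
  shows "D \<subseteq> DV F" "D \<subseteq> Pow (\<Union>e \<in> insert A H. vars F e)" "H \<subseteq> EXP F" "finite H" "A \<in> EXP F"
  using assms fs
  by (fastforce simp: formal_system_def is_statement_def pre_statement_def reduct_eq)+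

subsection \<open>Substitutions\<close>

lemma substitution_Nil: "\<sigma> [] = []" if "substitution F \<sigma>"
proof -
  have "\<sigma> ([] @ []) = \<sigma> [] @ \<sigma> []"
    using that unfolding substitution_def by blast
  then show ?thesis by simp
qed

lemma substitution_Cons:
  "\<sigma> (s # e) = \<sigma> [s] @ \<sigma> e"
  if "substitution F \<sigma>" "s \<in> CN F \<union> VR F" "e \<in> lists (CN F \<union> VR F)"
proof -
  have "[s] \<in> lists (CN F \<union> VR F)" using that by simp
  then have "\<sigma> ([s] @ e) = \<sigma> [s] @ \<sigma> e"
    using that(1,3) unfolding substitution_def by blast
  then show ?thesis by simp
qed

lemma substitution_eq_concat:
  assumes "substitution F \<sigma>" "e \<in> lists (CN F \<union> VR F)"
  shows "\<sigma> e = concat (map (\<lambda>s. \<sigma> [s]) e)"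
  using assms(2)
proof induction
  case Nil
  show ?case using substitution_Nil[OF assms(1)] by simp
next
  case (Cons s e)
  then show ?case using substitution_Cons[OF assms(1), of s e] by (metis concat.simps(2) list.map(2))
qed

lemma substitution_in_lists:
  "\<sigma> e \<in> lists (CN F \<union> VR F)" if "substitution F \<sigma>" "e \<in> lists (CN F \<union> VR F)"
  using that unfolding substitution_def by blast

text \<open>The first symbol of an expression is a constant, which every substitution fixes.\<close>

lemma substitution_EXP:
  assumes "substitution F \<sigma>" "e \<in> EXP F"
  shows "\<sigma> e \<in> EXP F" "hd (\<sigma> e) = hd e"
proof -
  obtain c f where e: "e = c # f" "c \<in> CN F" "f \<in> lists (CN F \<union> VR F)"
    using assms(2) by (cases e) (auto simp: EXP_def)
  then have "\<sigma> e = c # \<sigma> f"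
    using assms(1) substitution_Cons[of \<sigma> c f] by (simp add: substitution_def)
  moreover have "\<sigma> f \<in> lists (CN F \<union> VR F)"
    using substitution_in_lists assms(1) e(3) .
  ultimately show "\<sigma> e \<in> EXP F" "hd (\<sigma> e) = hd e"
    using e by (auto simp: EXP_def)
qed

text \<open>Finite sequences form a free monoid, so any choice of images for the variables extends
  to a substitution. Restricted substitutions and valuations of the term model are both obtained in
  this way.\<close>

lemma substitution_concat_map:
  assumes "\<And>c. c \<in> CN F \<Longrightarrow> f c = [c]"
    and "\<And>v. v \<in> VR F \<Longrightarrow> f v \<in> lists (CN F \<union> VR F)"
  shows "substitution F (\<lambda>e. concat (map f e))"
proof -
  have "f s \<in> lists (CN F \<union> VR F)" if "s \<in> CN F \<union> VR F" for s
    using assms that by fastforce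
  then show ?thesis
    using assms(1) by (fastforce simp: substitution_def)
qed

text \<open>Restricting a substitution to a set \<open>W\<close> of variables makes the requirement on all
  \<open>\<sigma>(VH\<^sub>v)\<close> in the closure rule a finitary one.\<close>

lemma substitution_restrict:
  assumes "substitution F \<sigma>"
  obtains \<tau> where "substitution F \<tau>"
    and "\<And>e. e \<in> EXP F \<Longrightarrow> vars F e \<subseteq> W \<Longrightarrow> \<tau> e = \<sigma> e"
    and "\<And>v. v \<in> VR F - W \<Longrightarrow> \<tau> (VH F v) = VH F v"
proof
  \<comment> \<open>Variables outside \<open>W\<close> are fixed; all other symbols are treated as
    by \<sigma>.\<close>
  define f where "f s = (if s \<in> VR F - W then [s] else \<sigma> [s])" for s
  show "substitution F (\<lambda>e. concat (map f e))"
  proof (rule substitution_concat_map)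
    show "f c = [c]" if "c \<in> CN F" for c
      using that assms by (auto simp: f_def substitution_def)
    show "f v \<in> lists (CN F \<union> VR F)" if "v \<in> VR F" for v
      using that substitution_in_lists[OF assms, of "[v]"] by (auto simp: f_def)
  qed
  show "concat (map f e) = \<sigma> e" if "e \<in> EXP F" "vars F e \<subseteq> W" for e
  proof -
    have "map f e = map (\<lambda>s. \<sigma> [s]) e"
      using that(2) by (auto simp: f_def vars_def)
    then show ?thesis
      using substitution_eq_concat[OF assms EXP_in_lists[OF that(1)]] by metis
  qed
  show "concat (map f (VH F v)) = VH F v" if "v \<in> VR F - W" for v
    using that assms Type_in_CN[of v] CN_not_VR[of "Type F v"]
    by (auto simp: VH_def f_def substitution_def)
qed

section \<open>Expressions and types in the closure\<close>

lemma fs_closure_in_EXP: "e \<in> EXP F" if "e \<in> fs_closure F D H" "H \<subseteq> EXP F"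
  using that(1)
proof induction
  case (ax D' H' A' \<sigma>)
  then show ?case using substitution_EXP(1) axiomD(5) by blast
qed (use that VH_in_EXP in auto)

text \<open>Universes exist only for types in \<open>TC F\<close>, so the term model needs this. An
  instance of an axiom has the type of the axiom's conclusion; for hypotheses the type has to be
  assumed.\<close>

lemma fs_closure_type:
  assumes "e \<in> fs_closure F D H" "\<forall>h \<in> H. hd h \<in> TC F"
  shows "hd e \<in> TC F"
  using assms(1)
proof induction
  case (var v)
  then show ?case using Type_in_TC by (simp add: VH_def)
next
  case (ax D' H' A' \<sigma>)
  then have "hd (\<sigma> A') = hd A'" using substitution_EXP(2) axiomD(5) by blast
  with ax.hyps show ?case by (auto simp: TC_def)
qed (use assms in auto)

subsection \<open>Soundness\<close>

context
  fixes M :: "('s, 'u) fs_model"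
  assumes M: "is_model F M"
begin

lemma freshness: "freshness_relation F (universe M) (fresh M)"
  using M by (simp add: is_model_def)

lemma fresh_sym: "(p, q) \<in> fresh M \<Longrightarrow> (q, p) \<in> fresh M"
  using freshness unfolding freshness_relation_def by (blast dest: symD)

context
  fixes \<mu> :: "'s \<Rightarrow> 'u"
  assumes \<mu>: "\<mu> \<in> VL F (universe M)"
begin

lemma eta_type:
  "e \<in> EXP F \<Longrightarrow> eta M \<mu> e = Some x \<Longrightarrow> hd e \<in> TC F \<and> x \<in> universe M (hd e)"
  using M \<mu> unfolding is_model_def by blast

lemma eta_VH: "v \<in> VR F \<Longrightarrow> eta M \<mu> (VH F v) = Some (\<mu> v)"
  using M \<mu> unfolding is_model_def by blast

lemma eta_axiom:
  "(D, H, A) \<in> Ax F \<Longrightarrow> respects_dv F M \<mu> D \<Longrightarrow> \<forall>h \<in> H. eta M \<mu> h \<noteq> None \<Longrightarrow> eta M \<mu> A \<noteq> None"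
  using M \<mu> unfolding is_model_def by blast

lemma eta_substitution:
  "substitution F \<sigma> \<Longrightarrow> \<forall>v \<in> VR F. eta M \<mu> (\<sigma> (VH F v)) \<noteq> None \<Longrightarrow> e \<in> EXP F \<Longrightarrow>
    eta M \<mu> (\<sigma> e) = eta M (subst_valuation F M \<sigma> \<mu>) e"
  using M \<mu> unfolding is_model_def by blast

lemma eta_cong:
  "\<nu> \<in> VL F (universe M) \<Longrightarrow> e \<in> EXP F \<Longrightarrow> \<forall>v \<in> vars F e. \<mu> v = \<nu> v \<Longrightarrow> eta M \<mu> e = eta M \<nu> e"
  using M \<mu> unfolding is_model_def by blast

lemma eta_fresh:
  "p \<in> DU F (universe M) \<Longrightarrow> e \<in> EXP F \<Longrightarrow> eta M \<mu> e = Some x \<Longrightarrow>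
    \<forall>w \<in> vars F e. (p, tagged F \<mu> w) \<in> fresh M \<Longrightarrow> (p, (hd e, x)) \<in> fresh M"
  using M \<mu> unfolding is_model_def by blast

text \<open>The freshness clause passes from variables to an expression on one side only. It is used
  first for \<open>e\<close> against each variable of \<open>f\<close>, turned around by symmetry,
  and used again for \<open>f\<close> against the value of \<open>e\<close>.\<close>

lemma eta_fresh_eta:
  assumes "e \<in> EXP F" "f \<in> EXP F" "eta M \<mu> e = Some x" "eta M \<mu> f = Some y"
    and "\<And>v w. v \<in> vars F e \<Longrightarrow> w \<in> vars F f \<Longrightarrow> (tagged F \<mu> v, tagged F \<mu> w) \<in> fresh M"
  shows "((hd e, x), (hd f, y)) \<in> fresh M"
proof (rule eta_fresh)
  show "(hd e, x) \<in> DU F (universe M)"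
    using eta_type assms by (auto simp: DU_def)
  show "\<forall>w \<in> vars F f. ((hd e, x), tagged F \<mu> w) \<in> fresh M"
  proof
    fix w assume w: "w \<in> vars F f"
    then have "tagged F \<mu> w \<in> DU F (universe M)"
      using tagged_in_DU[OF \<mu>] by (simp add: vars_def)
    then show "((hd e, x), tagged F \<mu> w) \<in> fresh M"
      using eta_fresh assms w fresh_sym by blast
  qed
qed (use assms in auto)

text \<open>Substitutions preserve types, so type correctness places the value of
  \<open>\<sigma> (VH F v)\<close> in the universe belonging to \<open>v\<close>.\<close>

lemma subst_valuation_in_VL:
  assumes "substitution F \<sigma>" "\<forall>v \<in> VR F. eta M \<mu> (\<sigma> (VH F v)) \<noteq> None"
  shows "subst_valuation F M \<sigma> \<mu> \<in> VL F (universe M)"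
proof -
  have "the (eta M \<mu> (\<sigma> (VH F v))) \<in> universe M (Type F v)" if v: "v \<in> VR F" for v
    using eta_type[OF substitution_EXP(1)[OF assms(1) VH_in_EXP[OF v]]]
      substitution_EXP(2)[OF assms(1) VH_in_EXP[OF v]] assms(2) v
    by (force simp: VH_def)
  then show ?thesis by (auto simp: subst_valuation_def VL_def)
qed

text \<open>This is the semantic form of condition (ii) of the closure rule: freshness between the
  variables of the substituted expressions passes to the values of those expressions.\<close>

lemma subst_valuation_respects_dv:
  assumes "substitution F \<sigma>" "\<forall>v \<in> VR F. eta M \<mu> (\<sigma> (VH F v)) \<noteq> None" "D \<subseteq> DV F"
    and "\<And>\<alpha> \<beta> \<gamma> \<delta>. {\<alpha>, \<beta>} \<in> D \<Longrightarrow> \<gamma> \<in> vars F (\<sigma> (VH F \<alpha>)) \<Longrightarrow> \<delta> \<in> vars F (\<sigma> (VH F \<beta>)) \<Longrightarrow>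
      (tagged F \<mu> \<gamma>, tagged F \<mu> \<delta>) \<in> fresh M"
  shows "respects_dv F M (subst_valuation F M \<sigma> \<mu>) D"
  unfolding respects_dv_def
proof (intro allI impI)
  fix \<alpha> \<beta> assume D: "{\<alpha>, \<beta>} \<in> D"
  then have \<alpha>: "\<alpha> \<in> VR F" and \<beta>: "\<beta> \<in> VR F"
    using pair_in_subset_DV[OF _ assms(3)] by auto
  \<comment> \<open>Writing the tag \<open>Type F v\<close> as the first symbol of
    \<open>\<sigma> (VH F v)\<close> brings the goal into the shape of
    \<open>eta_fresh_eta\<close>.\<close>
  have eq: "tagged F (subst_valuation F M \<sigma> \<mu>) v = (hd (\<sigma> (VH F v)), the (eta M \<mu> (\<sigma> (VH F v))))"
    if "v \<in> VR F" for v
    using that substitution_EXP(2)[OF assms(1) VH_in_EXP]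
    by (simp add: tagged_def subst_valuation_def VH_def)
  show "(tagged F (subst_valuation F M \<sigma> \<mu>) \<alpha>, tagged F (subst_valuation F M \<sigma> \<mu>) \<beta>) \<in> fresh M"
    unfolding eq[OF \<alpha>] eq[OF \<beta>]
    by (rule eta_fresh_eta)
      (use assms(2) assms(4)[OF D] \<alpha> \<beta> substitution_EXP(1)[OF assms(1) VH_in_EXP] in auto)
qed

end

text \<open>A freshness relation supplies elements fresh for finitely many others only, while
  \<open>D\<close> may be infinite. The induction therefore records a finite set \<open>V\<close> of
  variables whose pairs are all that the derivation relies on.\<close>

lemma soundness_finitary:
  assumes "e \<in> fs_closure F D H"
  shows "\<exists>V. finite V \<and> (\<forall>\<mu> \<in> VL F (universe M).
    respects_dv F M \<mu> (D \<inter> Pow V) \<and> (\<forall>h \<in> H. eta M \<mu> h \<noteq> None) \<longrightarrow> eta M \<mu> e \<noteq> None)"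
    (is "\<exists>V. finite V \<and> ?P e V")
  using assms
proof induction
  case (hyp e)
  then show ?case by (intro exI[of _ "{}"]) auto
next
  case (var v)
  then show ?case using eta_VH by (intro exI[of _ "{}"]) auto
next
  case (ax D' H' A' \<sigma>)
  note A' = axiomD[OF ax.hyps(1)]
  define W where "W = (\<Union>e \<in> insert A' H'. vars F e)"
  have W: "finite W" "W \<subseteq> VR F"
    using A' finite_vars by (auto simp: W_def vars_def)
  \<comment> \<open>The substitution \<tau> gives the same instance of the axiom as \<sigma>, but
    its values off \<open>W\<close> are variables and so are defined outright. Only finitely many
    induction hypotheses remain in use.\<close>
  obtain \<tau> where \<tau>: "substitution F \<tau>"
    and \<tau>_eq: "\<And>e. e \<in> EXP F \<Longrightarrow> vars F e \<subseteq> W \<Longrightarrow> \<tau> e = \<sigma> e"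
    and \<tau>_id: "\<And>v. v \<in> VR F - W \<Longrightarrow> \<tau> (VH F v) = VH F v"
    using substitution_restrict[OF ax.hyps(2)] by metis
  have \<tau>_VH: "\<tau> (VH F v) = \<sigma> (VH F v)" if "v \<in> W" for v
    using that W \<tau>_eq VH_in_EXP vars_VH by auto
  have "\<forall>e \<in> H' \<union> VH F ` W. \<exists>V. finite V \<and> ?P (\<sigma> e) V"
    using ax.IH W(2) by blast
  then obtain V where V: "\<And>e. e \<in> H' \<union> VH F ` W \<Longrightarrow> finite (V e) \<and> ?P (\<sigma> e) (V e)"
    by metis
  \<comment> \<open>The second union contains all variables that condition (ii) compares, so that
    every pair it demands lies inside \<open>V'\<close>.\<close>
  define V' where
    "V' = (\<Union>e \<in> H' \<union> VH F ` W. V e) \<union> (\<Union>v \<in> W. vars F (\<sigma> (VH F v)))"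
  have "finite V'"
    unfolding V'_def using V W(1) A'(4) finite_vars by blast
  moreover have "?P (\<sigma> A') V'"
  proof (intro ballI impI, elim conjE)
    fix \<mu> assume \<mu>: "\<mu> \<in> VL F (universe M)"
      and dv: "respects_dv F M \<mu> (D \<inter> Pow V')" and H: "\<forall>h \<in> H. eta M \<mu> h \<noteq> None"
    have def: "eta M \<mu> (\<sigma> e) \<noteq> None" if e: "e \<in> H' \<union> VH F ` W" for e
    proof -
      have "respects_dv F M \<mu> (D \<inter> Pow (V e))"
        by (rule respects_dv_mono[OF dv]) (use e in \<open>auto simp: V'_def\<close>)
      then show ?thesis using V[OF e] \<mu> H by blast
    qed
    have val: "\<forall>v \<in> VR F. eta M \<mu> (\<tau> (VH F v)) \<noteq> None"
    proof
      fix v assume "v \<in> VR F"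
      then show "eta M \<mu> (\<tau> (VH F v)) \<noteq> None"
        by (cases "v \<in> W") (use def \<tau>_VH \<tau>_id eta_VH[OF \<mu>] in auto)
    qed
    let ?\<nu> = "subst_valuation F M \<tau> \<mu>"
    \<comment> \<open>By the substitution property, evaluating the instance at \<mu> amounts to
      evaluating the axiom itself at \<open>?\<nu>\<close>.\<close>
    have eq: "eta M \<mu> (\<sigma> e) = eta M ?\<nu> e" if "e \<in> insert A' H'" for e
      using eta_substitution[OF \<mu> \<tau> val, of e] \<tau>_eq[of e] that A' unfolding W_def by fastforce
    have "respects_dv F M ?\<nu> D'"
    proof (rule subst_valuation_respects_dv[OF \<mu> \<tau> val A'(1)])
      fix \<alpha> \<beta> \<gamma> \<delta>
      assume D': "{\<alpha>, \<beta>} \<in> D'" and "\<gamma> \<in> vars F (\<tau> (VH F \<alpha>))" "\<delta> \<in> vars F (\<tau> (VH F \<beta>))"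
      \<comment> \<open>The pairs of an axiom lie within its own variables, where \<tau> and
        \<sigma> agree.\<close>
      moreover have W': "\<alpha> \<in> W" "\<beta> \<in> W"
        using D' A'(2) by (auto simp: W_def)
      ultimately have *: "\<gamma> \<in> vars F (\<sigma> (VH F \<alpha>))" "\<delta> \<in> vars F (\<sigma> (VH F \<beta>))"
        using \<tau>_VH by auto
      then have "{\<gamma>, \<delta>} \<in> D \<inter> Pow V'"
        using D' W' ax.hyps(3-) unfolding V'_def by blast
      then show "(tagged F \<mu> \<gamma>, tagged F \<mu> \<delta>) \<in> fresh M"
        using dv by (auto simp: respects_dv_def)
    qed
    moreover have "\<forall>h \<in> H'. eta M ?\<nu> h \<noteq> None"
    proof
      fix h assume "h \<in> H'"
      then show "eta M ?\<nu> h \<noteq> None" using def[of h] eq[of h] by simp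
    qed
    ultimately have "eta M ?\<nu> A' \<noteq> None"
      by (rule eta_axiom[OF subst_valuation_in_VL[OF \<mu> \<tau> val] ax.hyps(1)])
    then show "eta M \<mu> (\<sigma> A') \<noteq> None"
      using eq by simp
  qed
  ultimately show ?case by blast
qed

text \<open>The variables of \<open>V\<close> outside \<open>W\<close> receive new values one at a
  time, each fresh for the finitely many values already fixed. Values on \<open>W\<close> stay,
  since they determine the statement to be evaluated.\<close>

lemma fresh_extension:
  assumes \<mu>: "\<mu> \<in> VL F (universe M)" and D: "D \<subseteq> DV F" and "finite W"
    and dv: "respects_dv F M \<mu> (D \<inter> Pow W)" and V: "finite V" "V \<subseteq> VR F"
  shows "\<exists>\<nu> \<in> VL F (universe M). (\<forall>v \<in> W. \<nu> v = \<mu> v) \<and> respects_dv F M \<nu> (D \<inter> Pow (W \<union> V))"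
  using V
proof (induction V)
  case empty
  then show ?case using \<mu> dv by auto
next
  case (insert x V)
  then obtain \<nu> where \<nu>: "\<nu> \<in> VL F (universe M)" "\<forall>v \<in> W. \<nu> v = \<mu> v"
    and dv\<nu>: "respects_dv F M \<nu> (D \<inter> Pow (W \<union> V))"
    by auto
  show ?case
  proof (cases "x \<in> W")
    case True
    then show ?thesis using \<nu> dv\<nu> by (auto simp: insert_absorb)
  next
    case False
    have x: "x \<in> VR F" using insert by simp
    \<comment> \<open>These are the values to avoid; only variables are sure to have values in the
      disjoint union.\<close>
    let ?T = "tagged F \<nu> ` ((W \<union> V) \<inter> VR F)"
    have "finite ?T" "?T \<subseteq> DU F (universe M)"
      using \<open>finite W\<close> insert.hyps tagged_in_DU[OF \<nu>(1)] by auto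
    moreover have "Type F x \<in> VT F" using x by (simp add: VT_def)
    ultimately obtain u where u: "u \<in> universe M (Type F x)"
      and fresh: "\<forall>w \<in> ?T. ((Type F x, u), w) \<in> fresh M"
      using freshness unfolding freshness_relation_def by blast
    let ?\<nu> = "\<nu>(x := u)"
    have "?\<nu> \<in> VL F (universe M)"
      using \<nu>(1) u x by (auto simp: VL_def PiE_iff extensional_def)
    moreover have "\<forall>v \<in> W. ?\<nu> v = \<mu> v"
      using \<nu>(2) False by auto
    moreover have "respects_dv F M ?\<nu> (D \<inter> Pow (W \<union> insert x V))"
      unfolding respects_dv_def
    proof (intro allI impI)
      fix \<alpha> \<beta> assume d: "{\<alpha>, \<beta>} \<in> D \<inter> Pow (W \<union> insert x V)"
      then have ne: "\<alpha> \<in> VR F" "\<beta> \<in> VR F" "\<alpha> \<noteq> \<beta>"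
        using pair_in_subset_DV[OF _ D] by auto
      \<comment> \<open>Members of \<open>D\<close> have two distinct elements, so at most one is
        \<open>x\<close>. A pair with \<open>x\<close> is settled by the choice of \<open>u\<close>,
        any other by the induction hypothesis.\<close>
      consider "\<alpha> = x" | "\<beta> = x" | "\<alpha> \<noteq> x" "\<beta> \<noteq> x" by blast
      then show "(tagged F ?\<nu> \<alpha>, tagged F ?\<nu> \<beta>) \<in> fresh M"
      proof cases
        case 1
        then show ?thesis using ne d fresh by (auto simp: tagged_def)
      next
        case 2
        then show ?thesis using ne d fresh fresh_sym by (auto simp: tagged_def)
      next
        case 3
        then show ?thesis using d dv\<nu> by (auto simp: tagged_def respects_dv_def)
      qed
    qed
    ultimately show ?thesis by blast
  qed
qed

lemma soundness:
  assumes "is_theorem F S"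
  shows "statement_true_in F M S"
proof -
  obtain D H A where pre: "pre_statement F (D, H, A)" and A: "A \<in> fs_closure F D H"
    and S: "S = reduct F (D, H, A)"
    using assms by (auto simp: is_theorem_def provable_def)
  define W where "W = (\<Union>e \<in> insert A H. vars F e)"
  have D: "D \<subseteq> DV F" and H: "H \<subseteq> EXP F" "finite H" "A \<in> EXP F"
    using pre by (auto simp: pre_statement_def)
  have "finite W" using H finite_vars by (auto simp: W_def)
  obtain V where V: "finite V" and sound: "\<forall>\<mu> \<in> VL F (universe M).
      respects_dv F M \<mu> (D \<inter> Pow V) \<and> (\<forall>h \<in> H. eta M \<mu> h \<noteq> None) \<longrightarrow> eta M \<mu> A \<noteq> None"
    using soundness_finitary[OF A] by (elim exE conjE)
  have "eta M \<mu> A \<noteq> None"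
    if \<mu>: "\<mu> \<in> VL F (universe M)" and dv: "respects_dv F M \<mu> (D \<inter> Pow W)"
      and hyps: "\<forall>h \<in> H. eta M \<mu> h \<noteq> None" for \<mu>
  proof -
    obtain \<nu> where \<nu>: "\<nu> \<in> VL F (universe M)" and eq: "\<forall>v \<in> W. \<nu> v = \<mu> v"
      and dv\<nu>: "respects_dv F M \<nu> (D \<inter> Pow (W \<union> V \<inter> VR F))"
      using fresh_extension[OF \<mu> D \<open>finite W\<close> dv, of "V \<inter> VR F"] V by auto
    \<comment> \<open>The change from \<mu> to \<nu> is invisible to \<open>A\<close> and
      \<open>H\<close>, whose variables all lie in \<open>W\<close>.\<close>
    have eta: "eta M \<mu> e = eta M \<nu> e" if "e \<in> insert A H" for e
    proof (rule eta_cong[OF \<mu> \<nu>])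
      show "e \<in> EXP F" using that H by blast
      have "vars F e \<subseteq> W" using that unfolding W_def by blast
      then show "\<forall>v \<in> vars F e. \<mu> v = \<nu> v" using eq by auto
    qed
    \<comment> \<open>Members of \<open>D\<close> consist of variables, so cutting \<open>V\<close>
      down to \<open>VR F\<close> loses no pair.\<close>
    have "D \<inter> Pow V \<subseteq> D \<inter> Pow (W \<union> V \<inter> VR F)"
      using D by (auto simp: DV_def)
    with dv\<nu> have "respects_dv F M \<nu> (D \<inter> Pow V)"
      by (rule respects_dv_mono)
    moreover have "\<forall>h \<in> H. eta M \<nu> h \<noteq> None" using hyps eta by simp
    ultimately show ?thesis using bspec[OF sound \<nu>] eta by simp
  qed
  then show ?thesis by (simp add: S reduct_eq statement_true_in_def W_def)
qed

end

subsection \<open>Completeness\<close>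

text \<open>A value \<open>\<mu> v\<close> in the term model is an expression whose first symbol is the type of \<open>v\<close>.\<close>

definition subst_of :: "('s \<Rightarrow> 's list) \<Rightarrow> 's list \<Rightarrow> 's list" where
  "subst_of \<mu> e = concat (map (\<lambda>s. if s \<in> VR F then tl (\<mu> s) else [s]) e)"

text \<open>The values are derivable expressions, and \<eta> is substitution made partial: it is
  defined exactly where the resulting instance is derivable.\<close>

definition term_model :: "'s set set \<Rightarrow> 's list set \<Rightarrow> ('s, 's list) fs_model" where
  "term_model D H =
    (let U = (\<lambda>c. {e \<in> fs_closure F D H. hd e = c}) in
     \<lparr>universe = U,
      fresh = {(p, q) \<in> DU F U \<times> DU F U.
        \<forall>\<gamma> \<in> vars F (snd p). \<forall>\<delta> \<in> vars F (snd q). {\<gamma>, \<delta>} \<in> D},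
      eta = (\<lambda>\<mu> e. if subst_of \<mu> e \<in> fs_closure F D H then Some (subst_of \<mu> e) else None)\<rparr>)"

lemma universe_term_model: "universe (term_model D H) c = {e \<in> fs_closure F D H. hd e = c}"
  by (simp add: term_model_def Let_def)

lemma fresh_term_model:
  "(p, q) \<in> fresh (term_model D H) \<longleftrightarrow>
    p \<in> DU F (universe (term_model D H)) \<and> q \<in> DU F (universe (term_model D H)) \<and>
    (\<forall>\<gamma> \<in> vars F (snd p). \<forall>\<delta> \<in> vars F (snd q). {\<gamma>, \<delta>} \<in> D)"
  by (auto simp: term_model_def Let_def)

lemma eta_term_model:
  "eta (term_model D H) \<mu> e =
    (if subst_of \<mu> e \<in> fs_closure F D H then Some (subst_of \<mu> e) else None)"
  by (simp add: term_model_def Let_def)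

text \<open>The valuation by variables acts as the identity substitution, so under it definedness of
  \<open>e\<close> is membership of \<open>e\<close> in the closure.\<close>

lemma subst_of_VH_valuation: "subst_of (restrict (VH F) (VR F)) e = e"
  by (induction e) (auto simp: subst_of_def VH_def)

lemma subst_of_cong: "\<forall>v \<in> vars F e. \<mu> v = \<nu> v \<Longrightarrow> subst_of \<mu> e = subst_of \<nu> e"
  unfolding subst_of_def by (rule arg_cong[of _ _ concat]) (auto simp: vars_def)

lemma vars_subst_of: "vars F (subst_of \<mu> e) \<subseteq> (\<Union>v \<in> vars F e. vars F (\<mu> v))"
proof
  fix x assume "x \<in> vars F (subst_of \<mu> e)"
  then obtain s where s: "s \<in> set e" "x \<in> VR F" "x \<in> set (if s \<in> VR F then tl (\<mu> s) else [s])"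
    by (auto simp: vars_def subst_of_def)
  \<comment> \<open>If \<open>s\<close> were not a variable, \<open>x\<close> would equal
    \<open>s\<close>, although \<open>x\<close> is a variable.\<close>
  then have "s \<in> VR F" "x \<in> set (\<mu> s)"
    by (cases "\<mu> s"; simp split: if_splits)+
  with s show "x \<in> (\<Union>v \<in> vars F e. vars F (\<mu> v))"
    by (auto simp: vars_def)
qed

section \<open>The term model and its model clauses\<close>

context
  fixes D :: "'s set set" and H :: "'s list set" and V :: "'s set"
  assumes inf: "\<forall>c \<in> VT F. infinite {v \<in> VR F. Type F v = c}"
    and H: "H \<subseteq> EXP F" "\<forall>h \<in> H. hd h \<in> TC F"
    and V: "finite V" and D_V: "{d \<in> DV F. \<not> d \<subseteq> V} \<subseteq> D"
begin

private abbreviation "C \<equiv> fs_closure F D H"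
private abbreviation "T \<equiv> term_model D H"

lemma in_DU_T: "e \<in> C \<Longrightarrow> (hd e, e) \<in> DU F (universe T)"
  using fs_closure_type[OF _ H(2)] by (simp add: DU_def universe_term_model)

text \<open>Among the infinitely many variables of a type, one avoids \<open>V\<close> and every
  variable occurring in \<open>W\<close>. Pairs containing it are not subsets of \<open>V\<close>
  and hence belong to \<open>D\<close>.\<close>

lemma freshness_T: "freshness_relation F (universe T) (fresh T)"
  unfolding freshness_relation_def
proof (intro conjI ballI allI impI)
  show "fresh T \<subseteq> DU F (universe T) \<times> DU F (universe T)"
    by (auto simp: fresh_term_model)
  show "sym (fresh T)"
  proof (rule symI)
    fix p q assume pq: "(p, q) \<in> fresh T"
    have "{\<gamma>, \<delta>} \<in> D" if "\<gamma> \<in> vars F (snd q)" "\<delta> \<in> vars F (snd p)" for \<gamma> \<delta>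
      using pq that insert_commute[of \<gamma> \<delta> "{}"] by (simp add: fresh_term_model)
    then show "(q, p) \<in> fresh T"
      using pq by (simp add: fresh_term_model)
  qed
  fix c W assume c: "c \<in> VT F" and W: "finite W \<and> W \<subseteq> DU F (universe T)"
  have "finite (V \<union> (\<Union>w \<in> W. vars F (snd w)))"
    using W V finite_vars by auto
  then have "\<not> {v \<in> VR F. Type F v = c} \<subseteq> V \<union> (\<Union>w \<in> W. vars F (snd w))"
    using inf c finite_subset by blast
  then obtain v where v: "v \<in> VR F" "Type F v = c" "v \<notin> V" "\<forall>w \<in> W. v \<notin> vars F (snd w)"
    by blast
  have hd: "hd (VH F v) = c" using v by (simp add: VH_def)
  have VH: "VH F v \<in> C" using v(1) by (rule fs_closure.var)
  have "((c, VH F v), w) \<in> fresh T" if w: "w \<in> W" for w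
  proof -
    have "{v, \<delta>} \<in> D" if "\<delta> \<in> vars F (snd w)" for \<delta>
    proof -
      have "{v, \<delta>} \<in> DV F"
        using that v w by (auto simp: pair_in_DV_iff vars_def)
      then show ?thesis using D_V v(3) by blast
    qed
    then show ?thesis
      using in_DU_T[OF VH] hd w W v(1) by (auto simp: fresh_term_model vars_VH)
  qed
  then show "\<exists>e \<in> universe T c. \<forall>w \<in> W. ((c, e), w) \<in> fresh T"
    using VH hd by (intro bexI[of _ "VH F v"]) (auto simp: universe_term_model)
qed

context
  fixes \<mu> :: "'s \<Rightarrow> 's list"
  assumes \<mu>: "\<mu> \<in> VL F (universe T)"
begin

lemma valuation_T: "v \<in> VR F \<Longrightarrow> \<mu> v \<in> C \<and> hd (\<mu> v) = Type F v"
  using VL_mem[OF \<mu>] by (auto simp: universe_term_model)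

lemma valuation_T_in_EXP: "v \<in> VR F \<Longrightarrow> \<mu> v \<in> EXP F"
  using valuation_T fs_closure_in_EXP H(1) by blast

text \<open>The type symbol that \<open>tl\<close> removes from \<open>\<mu> v\<close> is restored
  by the first symbol of \<open>VH F v\<close>.\<close>

lemma subst_of_VH: "v \<in> VR F \<Longrightarrow> subst_of \<mu> (VH F v) = \<mu> v"
  using valuation_T[of v] valuation_T_in_EXP[of v] Type_in_CN[of v] CN_not_VR[of "Type F v"]
  by (cases "\<mu> v") (auto simp: subst_of_def VH_def EXP_def)

lemma substitution_subst_of: "substitution F (subst_of \<mu>)"
proof -
  have "tl (\<mu> v) \<in> lists (CN F \<union> VR F)" if "v \<in> VR F" for v
    using valuation_T_in_EXP[OF that] by (cases "\<mu> v") (auto simp: EXP_def)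
  then show ?thesis
    unfolding subst_of_def by (intro substitution_concat_map) (auto simp: CN_not_VR)
qed

text \<open>The valuation \<sigma>(\<mu>) corresponds to the composition of two substitutions. Both
  sides respect concatenation, so it suffices to compare them on single symbols.\<close>

lemma subst_of_subst_valuation:
  assumes \<sigma>: "substitution F \<sigma>" and def: "\<forall>v \<in> VR F. eta T \<mu> (\<sigma> (VH F v)) \<noteq> None"
    and e: "e \<in> lists (CN F \<union> VR F)"
  shows "subst_of (subst_valuation F T \<sigma> \<mu>) e = subst_of \<mu> (\<sigma> e)"
  using e
proof induction
  case Nil
  show ?case using substitution_Nil[OF \<sigma>] by (simp add: subst_of_def)
next
  case (Cons s e)
  have append: "subst_of \<nu> (f @ g) = subst_of \<nu> f @ subst_of \<nu> g" for \<nu> f g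
    by (simp add: subst_of_def)
  have "subst_of (subst_valuation F T \<sigma> \<mu>) [s] = subst_of \<mu> (\<sigma> [s])"
  proof (cases "s \<in> VR F")
    case True
    \<comment> \<open>The valuation knows \<open>\<sigma> [s]\<close> only through
      \<open>\<sigma> (VH F s)\<close>; the leading type symbol has to be split off.\<close>
    have "\<sigma> (VH F s) = Type F s # \<sigma> [s]"
      using substitution_Cons[OF \<sigma>, of "Type F s" "[s]"] \<sigma> True Type_in_CN[OF True]
      by (simp add: VH_def substitution_def)
    then have "subst_of \<mu> (\<sigma> (VH F s)) = Type F s # subst_of \<mu> (\<sigma> [s])"
      using CN_not_VR[OF Type_in_CN[OF True]] by (simp add: subst_of_def)
    moreover have "subst_valuation F T \<sigma> \<mu> s = subst_of \<mu> (\<sigma> (VH F s))"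
      using True def by (auto simp: subst_valuation_def eta_term_model split: if_splits)
    ultimately show ?thesis using True by (simp add: subst_of_def)
  next
    case False
    then show ?thesis using Cons.hyps \<sigma> by (simp add: subst_of_def substitution_def)
  qed
  then show ?case
    using Cons append[of _ "[s]" e] append substitution_Cons[OF \<sigma> Cons.hyps(1,2)] by simp
qed

text \<open>This is one use of the closure rule with the substitution \<open>subst_of \<mu>\<close>;
  freshness of the values is exactly its condition (ii).\<close>

lemma axiom_application_T:
  assumes A': "(D', H', A') \<in> Ax F" and dv: "respects_dv F T \<mu> D'"
    and hyps: "\<forall>h \<in> H'. eta T \<mu> h \<noteq> None"
  shows "eta T \<mu> A' \<noteq> None"
proof -
  have "subst_of \<mu> A' \<in> C"
  proof (rule fs_closure.ax[OF A' substitution_subst_of])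
    show "\<forall>h \<in> H'. subst_of \<mu> h \<in> C"
      using hyps by (auto simp: eta_term_model split: if_splits)
    show "\<forall>v \<in> VR F. subst_of \<mu> (VH F v) \<in> C"
      using subst_of_VH valuation_T by simp
    show "\<forall>\<alpha> \<beta> \<gamma> \<delta>. {\<alpha>, \<beta>} \<in> D' \<and> \<gamma> \<in> vars F (subst_of \<mu> (VH F \<alpha>)) \<and>
      \<delta> \<in> vars F (subst_of \<mu> (VH F \<beta>)) \<longrightarrow> {\<gamma>, \<delta>} \<in> D"
    proof (intro allI impI, elim conjE)
      fix \<alpha> \<beta> \<gamma> \<delta>
      assume d: "{\<alpha>, \<beta>} \<in> D'" "\<gamma> \<in> vars F (subst_of \<mu> (VH F \<alpha>))"
        "\<delta> \<in> vars F (subst_of \<mu> (VH F \<beta>))"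
      then have "\<alpha> \<in> VR F" "\<beta> \<in> VR F"
        using pair_in_subset_DV[OF _ axiomD(1)[OF A']] by auto
      with d dv show "{\<gamma>, \<delta>} \<in> D"
        by (auto simp: respects_dv_def fresh_term_model tagged_def subst_of_VH)
    qed
  qed
  then show ?thesis by (simp add: eta_term_model)
qed

lemma freshness_substitution_T:
  assumes p: "p \<in> DU F (universe T)" and e: "e \<in> EXP F" and x: "eta T \<mu> e = Some x"
    and fresh: "\<forall>w \<in> vars F e. (p, tagged F \<mu> w) \<in> fresh T"
  shows "(p, (hd e, x)) \<in> fresh T"
proof -
  have x_eq: "x = subst_of \<mu> e" "x \<in> C"
    using x by (auto simp: eta_term_model split: if_splits)
  then have "(hd e, x) \<in> DU F (universe T)"
    using in_DU_T substitution_EXP(2)[OF substitution_subst_of e] by metis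
  moreover have "{\<gamma>, \<delta>} \<in> D" if \<gamma>: "\<gamma> \<in> vars F (snd p)" and \<delta>: "\<delta> \<in> vars F x" for \<gamma> \<delta>
  proof -
    obtain w where "w \<in> vars F e" "\<delta> \<in> vars F (\<mu> w)"
      using \<delta> x_eq(1) vars_subst_of by blast
    then show ?thesis
      using fresh \<gamma> by (auto simp: fresh_term_model tagged_def)
  qed
  ultimately show ?thesis using p by (simp add: fresh_term_model)
qed

lemma type_correct_T:
  assumes "e \<in> EXP F" "eta T \<mu> e = Some x"
  shows "hd e \<in> TC F" "x \<in> universe T (hd e)"
proof -
  have "x = subst_of \<mu> e" "x \<in> C"
    using assms(2) by (auto simp: eta_term_model split: if_splits)
  then show "hd e \<in> TC F" "x \<in> universe T (hd e)"
    using fs_closure_type[of x D H] H(2) substitution_EXP(2)[OF substitution_subst_of assms(1)]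
    by (auto simp: universe_term_model)
qed

end

lemma is_model_T: "is_model F T"
  unfolding is_model_def
proof (intro conjI ballI)
  show "freshness_relation F (universe T) (fresh T)" by (rule freshness_T)
  fix \<mu> assume \<mu>: "\<mu> \<in> VL F (universe T)"
  show "\<forall>x. eta T \<mu> e = Some x \<longrightarrow> hd e \<in> TC F \<and> x \<in> universe T (hd e)" if "e \<in> EXP F" for e
    using type_correct_T[OF \<mu> that] by blast
  show "eta T \<mu> (VH F v) = Some (\<mu> v)" if "v \<in> VR F" for v
    using subst_of_VH[OF \<mu> that] valuation_T[OF \<mu> that] by (simp add: eta_term_model)
  show "case S of (D', H', A') \<Rightarrow> respects_dv F T \<mu> D' \<and> (\<forall>h \<in> H'. eta T \<mu> h \<noteq> None) \<longrightarrow>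
      eta T \<mu> A' \<noteq> None" if "S \<in> Ax F" for S
    using axiom_application_T[OF \<mu>] that by blast
  show "\<forall>\<sigma>. substitution F \<sigma> \<and> (\<forall>v \<in> VR F. eta T \<mu> (\<sigma> (VH F v)) \<noteq> None) \<longrightarrow>
      (\<forall>e \<in> EXP F. eta T \<mu> (\<sigma> e) = eta T (subst_valuation F T \<sigma> \<mu>) e)"
    using subst_of_subst_valuation[OF \<mu>] EXP_in_lists by (simp add: eta_term_model)
  show "(\<forall>v \<in> vars F e. \<mu> v = \<nu> v) \<longrightarrow> eta T \<mu> e = eta T \<nu> e" for \<nu> e
    using subst_of_cong[of e \<mu> \<nu>] by (simp add: eta_term_model)
  show "\<forall>x. eta T \<mu> e = Some x \<and> (\<forall>w \<in> vars F e. (p, tagged F \<mu> w) \<in> fresh T) \<longrightarrow>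
      (p, (hd e, x)) \<in> fresh T" if "p \<in> DU F (universe T)" "e \<in> EXP F" for p e
    using freshness_substitution_T[OF \<mu> that] by blast
qed

section \<open>The valuation by variables and completeness\<close>

lemma VH_valuation:
  "restrict (VH F) (VR F) \<in> VL F (universe T)"
  by (auto simp: VL_def universe_term_model VH_def intro: fs_closure.var[unfolded VH_def])

text \<open>Since \<alpha> is the only variable of \<open>VH F \<alpha>\<close>, freshness between
  two such expressions reduces to a single pair in \<open>D\<close>.\<close>

lemma VH_valuation_respects_dv:
  assumes "E \<subseteq> D \<inter> DV F"
  shows "respects_dv F T (restrict (VH F) (VR F)) E"
  unfolding respects_dv_def
proof (intro allI impI)
  fix \<alpha> \<beta> assume E: "{\<alpha>, \<beta>} \<in> E"
  then have "\<alpha> \<in> VR F" "\<beta> \<in> VR F"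
    using pair_in_subset_DV[of \<alpha> \<beta> E] assms by auto
  then show "(tagged F (restrict (VH F) (VR F)) \<alpha>, tagged F (restrict (VH F) (VR F)) \<beta>) \<in> fresh T"
    using E assms tagged_in_DU[OF VH_valuation]
    by (auto simp: fresh_term_model) (auto simp: tagged_def vars_VH)
qed

end

text \<open>Truth in the term model, read at the valuation by variables, yields a derivation of
  \<open>A\<close> relative to the extended conditions \<open>E\<close>. The assumption
  \<open>types\<close> places every member of the closure in a universe.\<close>

lemma completeness:
  assumes inf: "\<forall>c \<in> VT F. infinite {v \<in> VR F. Type F v = c}"
    and pre: "pre_statement F (D, H, A)" and types: "\<forall>h \<in> H. hd h \<in> TC F"
    and true: "\<And>M :: ('s, 's list) fs_model.
      is_model F M \<Longrightarrow> statement_true_in F M (reduct F (D, H, A))"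
  shows "is_theorem F (reduct F (D, H, A))"
proof -
  define V where "V = (\<Union>e \<in> insert A H. vars F e)"
  define E where "E = D \<inter> Pow V \<union> {d \<in> DV F. \<not> d \<subseteq> V}"
  let ?VH = "restrict (VH F) (VR F)"
  have D: "D \<subseteq> DV F" and H: "H \<subseteq> EXP F" "finite H" and A: "A \<in> EXP F"
    using pre by (auto simp: pre_statement_def)
  have V: "finite V" using H finite_vars by (auto simp: V_def)
  have E: "{d \<in> DV F. \<not> d \<subseteq> V} \<subseteq> E" "E \<subseteq> DV F" "D \<inter> Pow V \<subseteq> E \<inter> DV F"
    using D by (auto simp: E_def)
  note setting = inf H(1) types V E(1)
  have "eta (term_model E H) ?VH h \<noteq> None" if "h \<in> H" for h
    using that by (simp add: eta_term_model subst_of_VH_valuation fs_closure.hyp)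
  then have "eta (term_model E H) ?VH A \<noteq> None"
    using true[OF is_model_T[OF setting]] VH_valuation[OF setting]
      VH_valuation_respects_dv[OF setting E(3)]
    by (auto simp: statement_true_in_def reduct_eq V_def)
  then have "A \<in> fs_closure F E H"
    by (simp add: eta_term_model subst_of_VH_valuation split: if_splits)
  \<comment> \<open>The pairs added in \<open>E\<close> are not subsets of \<open>V\<close>, so the
    reduct discards them again.\<close>
  moreover have "reduct F (D, H, A) = reduct F (E, H, A)"
    unfolding reduct_eq V_def[symmetric] by (auto simp: E_def)
  moreover have "pre_statement F (E, H, A)"
    using pre E(2) by (simp add: pre_statement_def)
  ultimately show ?thesis
    unfolding is_theorem_def provable_def by blast
qed

end

section \<open>Completeness for statements without hypotheses\<close>

theorem corollary1:
  fixes F :: "'s formal_system" and A :: "'s list"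
  assumes "formal_system F"
    and "\<forall>c \<in> VT F. infinite {v \<in> VR F. Type F v = c}"
    and "A \<in> EXP F"
  shows "(is_theorem F (reduct F (DV F, {}, A)) \<longleftrightarrow>
            (\<forall>M :: ('s, 'u) fs_model.
               is_model F M \<longrightarrow> statement_true_in F M (reduct F (DV F, {}, A))) \<and>
            (\<forall>M :: ('s, 's list) fs_model.
               is_model F M \<longrightarrow> statement_true_in F M (reduct F (DV F, {}, A)))) \<and>
         (is_theorem F ({}, {}, A) \<longleftrightarrow>
            (\<forall>M :: ('s, 'u) fs_model. is_model F M \<longrightarrow> true_in F M A) \<and>
            (\<forall>M :: ('s, 's list) fs_model. is_model F M \<longrightarrow> true_in F M A))"
proof -
  \<comment> \<open>Both halves of the claim are instances of this equivalence, with
    \<open>D\<close> equal to \<open>DV F\<close> and to the empty set. The term models used for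
    completeness have elements of type \<open>'s list\<close>.\<close>
  have iff: "is_theorem F (reduct F (D, {}, A)) \<longleftrightarrow>
      (\<forall>M :: ('s, 'u) fs_model.
         is_model F M \<longrightarrow> statement_true_in F M (reduct F (D, {}, A))) \<and>
      (\<forall>M :: ('s, 's list) fs_model.
         is_model F M \<longrightarrow> statement_true_in F M (reduct F (D, {}, A)))" (is "?thm \<longleftrightarrow> ?true")
    if "D \<subseteq> DV F" for D
  proof
    assume ?thm
    then show ?true
      by (intro conjI allI impI soundness[OF assms(1)])
  next
    assume ?true
    then show ?thm
      using that assms(3)
      by (intro completeness[OF assms(1,2)]) (auto simp: pre_statement_def)
  qed
  have empty: "reduct F ({}, {}, A) = ({}, {}, A)"
    by (simp add: reduct_eq)
  have true_iff: "statement_true_in F M ({}, {}, A) \<longleftrightarrow> true_in F M A" for M :: "('s, 'v) fs_model"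
    by (simp add: statement_true_in_def true_in_def respects_dv_def)
  show ?thesis
    using iff[of "DV F"] iff[of "{}"] unfolding empty true_iff by simp
qed

end
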